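(* Let $A\neq\{0\}$ be a topological algebra which is either a uniform topological algebra or a saturated locally convex algebra. Then $A$ satisfies property (P): $M^*(A)\neq\emptyset$ and the topology of $A$ is determined by a family $\{p_s:s\in S\}$ of seminorms such that for all $x\in A$ and every $s\in S$ with $p_s(x)=1$, there exists $f_0\in M^*(A)$ with $|f_0(x)|\ge 1$.
   Context: A topological algebra is an (associative, not necessarily commutative or unital) algebra over $\mathbb{C}$ which is also a Hausdorff topological vector space such that the multiplication is separately continuous; a locally convex algebra is a topological algebra whose topology is locally convex. $M^*(A)$ denotes the set of all nonzero multiplicative linear functionals $A\to\mathbb{C}$ (not necessarily continuous). A uniform seminorm on $A$ is a seminorm $p$ with $p(x^2)=p(x)^2$ for all $x\in A$; a uniform topological algebra is a topological algebra whose topology is determined by a family of uniform seminorms. A locally convex algebra $A$ with unit $e$ and $M^*(A)\neq\emptyset$ is saturated if its topology is determined by a family $\{p_s:s\in S\}$ of seminorms such that (a) $p_s(e)=1$ for all $s\in S$, and (b) for all $x\in A$ and $s\in S$ with $p_s(x)=1$, there exist $f_0,f\in M^*(A)$ such that $|f_0(x)|=\sup\{|f(y)|: y\in A,\ p_s(y)\le 1\}$. *)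

theory Defs
  imports "HOL-Analysis.Analysis"
begin

locale complex_algebra = vector_space smul
  for smul :: "complex \<Rightarrow> 'a::ring \<Rightarrow> 'a" +
  assumes smul_mult_left: "smul c x * y = smul c (x * y)"
    and smul_mult_right: "x * smul c y = smul c (x * y)"

text \<open>The Hausdorff property and joint continuity of addition come from the sort of the carrier
  type.\<close>

locale topological_algebra = complex_algebra smul
  for smul :: "complex \<Rightarrow> 'a::{ring, t2_space, topological_ab_group_add} \<Rightarrow> 'a" +
  assumes continuous_smul: "continuous_on UNIV (\<lambda>(c, x). smul c x)"
    and continuous_mult_left: "continuous_on UNIV (\<lambda>x::'a. a * x)"
    and continuous_mult_right: "continuous_on UNIV (\<lambda>x::'a. x * a)"

definition characters :: "(complex \<Rightarrow> 'a::ring \<Rightarrow> 'a) \<Rightarrow> ('a \<Rightarrow> complex) set" where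
  "characters smul =
    {f. Vector_Spaces.linear smul (*) f \<and> (\<forall>x y. f (x * y) = f x * f y) \<and> f \<noteq> (\<lambda>_. 0)}"

definition seminorm :: "(complex \<Rightarrow> 'a::ring \<Rightarrow> 'a) \<Rightarrow> ('a \<Rightarrow> real) \<Rightarrow> bool" where
  "seminorm smul p \<longleftrightarrow>
    (\<forall>x. 0 \<le> p x) \<and> (\<forall>x y. p (x + y) \<le> p x + p y) \<and> (\<forall>c x. p (smul c x) = cmod c * p x)"

definition uniform_seminorm :: "(complex \<Rightarrow> 'a::ring \<Rightarrow> 'a) \<Rightarrow> ('a \<Rightarrow> real) \<Rightarrow> bool" where
  "uniform_seminorm smul p \<longleftrightarrow> seminorm smul p \<and> (\<forall>x. p (x * x) = (p x)\<^sup>2)"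

text \<open>Families of seminorms are represented by their sets of members; the open semiballs form a
  subbase, so the family need not be directed.\<close>

definition determines_topology :: "('a::{ring, topological_space} \<Rightarrow> real) set \<Rightarrow> bool" where
  "determines_topology P \<longleftrightarrow>
    (open :: 'a set \<Rightarrow> bool) =
      generate_topology {{y. p (y - x) < r} |p x r. p \<in> P \<and> 0 < r}"

definition uniform_topological_algebra ::
    "(complex \<Rightarrow> 'a::{ring, t2_space, topological_ab_group_add} \<Rightarrow> 'a) \<Rightarrow> bool" where
  "uniform_topological_algebra smul \<longleftrightarrow>
    topological_algebra smul \<and>
    (\<exists>P. (\<forall>p\<in>P. uniform_seminorm smul p) \<and> determines_topology P)"

text \<open>The library constant \<open>convex\<close> needs the class \<open>real_vector\<close>, which the carrier type does
  not have.\<close>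

definition convex_set :: "(complex \<Rightarrow> 'a::ring \<Rightarrow> 'a) \<Rightarrow> 'a set \<Rightarrow> bool" where
  "convex_set smul C \<longleftrightarrow>
    (\<forall>x\<in>C. \<forall>y\<in>C. \<forall>u\<ge>0. \<forall>v\<ge>0. u + v = 1 \<longrightarrow>
      smul (complex_of_real u) x + smul (complex_of_real v) y \<in> C)"

definition locally_convex_algebra ::
    "(complex \<Rightarrow> 'a::{ring, t2_space, topological_ab_group_add} \<Rightarrow> 'a) \<Rightarrow> bool" where
  "locally_convex_algebra smul \<longleftrightarrow>
    topological_algebra smul \<and>
    (\<forall>U. open U \<and> 0 \<in> U \<longrightarrow> (\<exists>C. convex_set smul C \<and> 0 \<in> interior C \<and> C \<subseteq> U))"

text \<open>The supremum is taken in the extended reals, so that its equality with a real number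
  includes its finiteness.\<close>

definition saturated_algebra ::
    "(complex \<Rightarrow> 'a::{ring, t2_space, topological_ab_group_add} \<Rightarrow> 'a) \<Rightarrow> bool" where
  "saturated_algebra smul \<longleftrightarrow>
    locally_convex_algebra smul \<and> characters smul \<noteq> {} \<and>
    (\<exists>e. (\<forall>x. e * x = x \<and> x * e = x) \<and>
      (\<exists>P. (\<forall>p\<in>P. seminorm smul p) \<and> determines_topology P \<and>
        (\<forall>p\<in>P. p e = 1) \<and>
        (\<forall>x. \<forall>p\<in>P. p x = 1 \<longrightarrow>
          (\<exists>f\<^sub>0\<in>characters smul. \<exists>f\<in>characters smul.
            ereal (cmod (f\<^sub>0 x)) = (SUP y\<in>{y. p y \<le> 1}. ereal (cmod (f y)))))))"

definition property_P ::
    "(complex \<Rightarrow> 'a::{ring, t2_space, topological_ab_group_add} \<Rightarrow> 'a) \<Rightarrow> bool" where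
  "property_P smul \<longleftrightarrow>
    characters smul \<noteq> {} \<and>
    (\<exists>P. (\<forall>p\<in>P. seminorm smul p) \<and> determines_topology P \<and>
      (\<forall>x. \<forall>p\<in>P. p x = 1 \<longrightarrow> (\<exists>f\<^sub>0\<in>characters smul. 1 \<le> cmod (f\<^sub>0 x))))"

end

theory Submission
  imports Defs "HOL-Real_Asymp.Real_Asymp"
begin

text \<open>In the saturated case \<open>f e = 1\<close> for every character \<open>f\<close>, so the supremum in question is at
  least \<open>1\<close>. In the uniform case, the Jordan identities show that a seminorm \<open>p\<close> with the square
  property satisfies \<open>p (x y) \<le> 6 p x p y\<close> (Dedania), a Liouville argument for \<open>exp (- l y) x exp (l y)\<close>
  shows that \<open>p\<close> vanishes on commutators (Hirschfeld and Zelazko), and the Hausdorff property then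
  makes the algebra commutative. Given \<open>p x = 1\<close>, a minimal uniform seminorm \<open>q\<close> with \<open>q x = 1\<close> is
  multiplicative, and by the theorem of Gelfand and Mazur the quotient by its kernel is \<open>\<complex>\<close>. Neither
  completions nor units are needed: powers \<open>2 ^ k\<close>, averages over roots of unity and Ostrowski's
  factorization argument replace the exponential and the resolvent.\<close>

section \<open>Elementary real inequalities\<close>

text \<open>If \<open>s > t > 0\<close>, then \<open>(s / t) ^ 2 ^ k\<close> outgrows every
  \<open>K * C ^ k\<close>. Estimates that lose a constant at each of \<open>k\<close> squarings are
  thus freed of the constants by taking roots.\<close>

lemma le_of_power_two_power_bound:
  fixes s t K C :: real
  assumes "0 \<le> s" "0 \<le> t" "0 < C" and bound: "\<And>k. s ^ 2 ^ k \<le> K * C ^ k * t ^ 2 ^ k"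
  shows "s \<le> t"
proof (rule ccontr)
  assume "\<not> s \<le> t"
  then have "t < s" by simp
  have "0 < t"
    using bound[of 0] assms(2) \<open>t < s\<close> by (cases "t = 0") auto
  define r where "r = s / t"
  have "1 < r"
    using \<open>t < s\<close> \<open>0 < t\<close> by (simp add: r_def)
  have "r ^ 2 ^ k / C ^ k \<le> K" for k
    using bound[of k] \<open>0 < t\<close> \<open>0 < C\<close> by (simp add: r_def field_simps)
  moreover have "filterlim (\<lambda>k::nat. r ^ 2 ^ k / C ^ k) at_top at_top"
    using \<open>1 < r\<close> \<open>0 < C\<close> by real_asymp
  ultimately show False
    unfolding filterlim_at_top_dense eventually_sequentially by (meson not_le order_refl)
qed

lemma four_mult_bound_of_scaling:
  fixes c \<alpha> \<beta> :: real
  assumes "0 \<le> \<alpha>" "0 \<le> \<beta>" and bound: "\<And>t. 0 < t \<Longrightarrow> c \<le> (t * \<alpha> + \<beta> / t)\<^sup>2"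
  shows "c \<le> 4 * \<alpha> * \<beta>"
proof (rule tendsto_lowerbound)
  show "((\<lambda>d. 4 * (\<alpha> + d) * (\<beta> + d)) \<longlongrightarrow> 4 * \<alpha> * \<beta>) (at_right 0)"
    by (auto intro!: tendsto_eq_intros)
  have "c \<le> 4 * (\<alpha> + d) * (\<beta> + d)" if "0 < d" for d
  proof -
    \<comment> \<open>This choice balances the two terms; the shift by \<open>d\<close> keeps it
      defined and positive when \<alpha> or \<beta> vanishes.\<close>
    define t where "t = sqrt ((\<beta> + d) / (\<alpha> + d))"
    have pos: "0 < \<alpha> + d" "0 < \<beta> + d"
      using assms(1,2) that by simp_all
    then have t: "0 < t" "t\<^sup>2 = (\<beta> + d) / (\<alpha> + d)"
      by (simp_all add: t_def)
    have "c \<le> (t * \<alpha> + \<beta> / t)\<^sup>2"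
      using bound t by simp
    also have "\<dots> \<le> (t * (\<alpha> + d) + (\<beta> + d) / t)\<^sup>2"
      using assms(1,2) that t by (intro power_mono add_mono mult_left_mono divide_right_mono) simp_all
    also have "\<dots> = t\<^sup>2 * (\<alpha> + d)\<^sup>2 + 2 * (\<alpha> + d) * (\<beta> + d) + (\<beta> + d)\<^sup>2 / t\<^sup>2"
      using t(1) by (simp add: power2_eq_square field_simps)
    also have "\<dots> = 4 * (\<alpha> + d) * (\<beta> + d)"
      using pos unfolding t(2) by (simp add: power2_eq_square) (simp add: algebra_simps)
    finally show ?thesis .
  qed
  then show "\<forall>\<^sub>F d in at_right 0. c \<le> 4 * (\<alpha> + d) * (\<beta> + d)"
    by (auto intro: eventually_at_rightI[of 0 1])
qed simp

section \<open>Uniform seminorms\<close>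

primrec dyadic_power :: "'a::semigroup_mult \<Rightarrow> nat \<Rightarrow> 'a" where
  "dyadic_power x 0 = x"
| "dyadic_power x (Suc k) = dyadic_power x k * dyadic_power x k"

text \<open>In a ring without unit, this is \<open>x ^ (2 ^ Suc k - 1)\<close>.\<close>

primrec dyadic_power_pred :: "'a::semigroup_mult \<Rightarrow> nat \<Rightarrow> 'a" where
  "dyadic_power_pred x 0 = x"
| "dyadic_power_pred x (Suc k) = dyadic_power_pred x k * dyadic_power x (Suc k)"

lemma dyadic_power_pred_mult:
  "dyadic_power_pred x k * x = dyadic_power x (Suc k) \<and>
   x * dyadic_power_pred x k = dyadic_power x (Suc k)"
proof (induction k)
  case (Suc k)
  let ?e = "dyadic_power_pred x k" and ?w = "dyadic_power x (Suc k)"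
  have "?w * x = x * ?w"
    using Suc by (metis mult.assoc)
  then show ?case
    using Suc by (simp del: dyadic_power.simps add: dyadic_power.simps(2)[of x "Suc k"]) (metis mult.assoc)
qed simp

text \<open>With a formal unit and \<open>n = 2 ^ Suc k\<close>, this is
  \<open>((1 + b) a)^n = (1 + b) (a (1 + b))^(n - 1) a\<close>, multiplied out.\<close>

lemma dyadic_power_add_mult:
  fixes a b :: "'a::ring"
  shows "dyadic_power (a + b * a) (Suc k) =
    dyadic_power_pred (a + a * b) k * a + b * dyadic_power_pred (a + a * b) k * a"
proof (induction k)
  case 0
  show ?case by (simp add: algebra_simps)
next
  case (Suc k)
  let ?t = "a + a * b"
  let ?e = "dyadic_power_pred ?t k"
  have e: "dyadic_power_pred ?t (Suc k) = ?e * (?t * ?e)"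
    using dyadic_power_pred_mult[of ?t k] by simp
  have "dyadic_power (a + b * a) (Suc (Suc k)) = (?e * a + b * ?e * a) * (?e * a + b * ?e * a)"
    using Suc by simp
  also have "\<dots> = ?e * (?t * ?e) * a + b * (?e * (?t * ?e)) * a"
    by (simp add: algebra_simps)
  finally show ?case
    by (simp only: e)
qed

section \<open>Dedania's inequality and cyclic invariance\<close>

locale seminormed_algebra = complex_algebra smul
  for smul :: "complex \<Rightarrow> 'a::ring \<Rightarrow> 'a" and p :: "'a \<Rightarrow> real" +
  assumes seminorm: "seminorm smul p"
begin

lemma nonneg [simp]: "0 \<le> p x"
  and triangle: "p (x + y) \<le> p x + p y"
  and homogeneous: "p (smul c x) = cmod c * p x"
  using seminorm by (auto simp: seminorm_def)

lemma zero [simp]: "p 0 = 0"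
  using homogeneous[of 0 0] by simp

lemma minus [simp]: "p (- x) = p x"
  using homogeneous[of "-1" x] by simp

lemma triangle_diff: "p (x - y) \<le> p x + p y"
  using triangle[of x "- y"] by simp

lemma diff_le: "p x - p y \<le> p (x - y)"
  using triangle[of "x - y" y] by simp

lemma double: "p (x + x) = 2 * p x"
  using homogeneous[of 2 x] scale_left_distrib[of 1 1 x] by simp

lemma eq_of_diff_zero:
  assumes "p (x - y) = 0"
  shows "p x = p y"
  using diff_le[of x y] diff_le[of y x] assms minus[of "x - y"] by simp

lemma sum_le: "p (\<Sum>i\<in>I. g i) \<le> (\<Sum>i\<in>I. p (g i))"
proof (induction I rule: infinite_finite_induct)
  case (insert i I)
  then show ?case
    using triangle[of "g i" "sum g I"] by simp
qed simp_all

end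

locale uniform_seminormed_algebra = seminormed_algebra smul p
  for smul :: "complex \<Rightarrow> 'a::ring \<Rightarrow> 'a" and p :: "'a \<Rightarrow> real" +
  assumes square: "p (x * x) = (p x)\<^sup>2"
begin

text \<open>Polarization: \<open>(u + v)^2 - (u - v)^2 = 2 (u v + v u)\<close>. Replacing
  \<open>x, y\<close> by \<open>t x, y / t\<close> preserves the products, and optimizing
  \<open>t\<close> turns a bound by the square of a sum into one by a product.\<close>

lemma anticommutator_le: "p (x * y + y * x) \<le> 4 * p x * p y"
proof (rule four_mult_bound_of_scaling)
  fix t :: real
  assume "0 < t"
  define u v where "u = smul (of_real t) x" and "v = smul (of_real (1 / t)) y"
  have uv: "u * v = x * y" "v * u = y * x"
    using \<open>0 < t\<close> by (simp_all add: u_def v_def smul_mult_left smul_mult_right)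
  have "2 * p (u * v + v * u) = p ((u + v) * (u + v) - (u - v) * (u - v))"
    unfolding double[symmetric] by (rule arg_cong[of _ _ p]) (simp add: algebra_simps)
  also have "\<dots> \<le> (p (u + v))\<^sup>2 + (p (u - v))\<^sup>2"
    using triangle_diff square by metis
  also have "\<dots> \<le> (p u + p v)\<^sup>2 + (p u + p v)\<^sup>2"
    by (intro add_mono power_mono triangle triangle_diff) simp_all
  finally have "p (u * v + v * u) \<le> (p u + p v)\<^sup>2"
    by simp
  then show "p (x * y + y * x) \<le> (t * p x + p y / t)\<^sup>2"
    using \<open>0 < t\<close> by (simp add: uv) (simp add: u_def v_def homogeneous norm_divide)
qed simp_all

text \<open>The Jordan identity \<open>2 x y x = x o (x o y) - (x x) o y\<close>, with
  \<open>o\<close> the anticommutator, reduces this to \<open>anticommutator_le\<close>: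
  \<open>(4 * 4 + 4) / 2 = 10\<close>.\<close>

lemma mult_mult_same_le: "p (x * y * x) \<le> 10 * (p x)\<^sup>2 * p y"
proof -
  let ?j = "x * y + y * x"
  have "2 * p (x * y * x) = p ((x * ?j + ?j * x) - (x * x * y + y * (x * x)))"
    unfolding double[symmetric] by (rule arg_cong[of _ _ p]) (simp add: algebra_simps)
  also have "\<dots> \<le> 4 * p x * p ?j + 4 * p (x * x) * p y"
    using triangle_diff anticommutator_le by (meson add_mono order_trans)
  also have "\<dots> \<le> 4 * p x * (4 * p x * p y) + 4 * p (x * x) * p y"
    by (intro add_mono mult_left_mono anticommutator_le) simp_all
  finally show ?thesis
    by (simp add: square power2_eq_square algebra_simps)
qed

text \<open>The square of a commutator is a Jordan expression in \<open>x\<close> and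
  \<open>y\<close>, so the two previous bounds apply: \<open>40 + 10 + 10 = 60\<close>, which is
  below \<open>8^2\<close>.\<close>

lemma commutator_le: "p (x * y - y * x) \<le> 8 * p x * p y"
proof -
  let ?c = "x * y - y * x" and ?z = "y * x * y"
  have "(p ?c)\<^sup>2 = p ((x * ?z + ?z * x) - (x * (y * y) * x + y * (x * x) * y))"
    unfolding square[symmetric] by (rule arg_cong[of _ _ p]) (simp add: algebra_simps)
  also have "\<dots> \<le> 4 * p x * p ?z + (10 * (p x)\<^sup>2 * p (y * y) + 10 * (p y)\<^sup>2 * p (x * x))"
    by (meson triangle_diff triangle anticommutator_le mult_mult_same_le add_mono order_trans)
  also have "\<dots> \<le> 4 * p x * (10 * (p y)\<^sup>2 * p x) + (10 * (p x)\<^sup>2 * p (y * y) + 10 * (p y)\<^sup>2 * p (x * x))"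
    by (intro add_mono mult_left_mono mult_mult_same_le order_refl) simp_all
  also have "\<dots> = 60 * (p x * p y)\<^sup>2"
    by (simp add: square power2_eq_square algebra_simps)
  also have "\<dots> \<le> (8 * (p x * p y))\<^sup>2"
    by (simp add: power_mult_distrib)
  finally show ?thesis
    by (metis mult.assoc mult_nonneg_nonneg nonneg power2_le_imp_le zero_le_numeral)
qed

lemma mult_le_six: "p (x * y) \<le> 6 * p x * p y"
proof -
  have "2 * p (x * y) = p ((x * y + y * x) + (x * y - y * x))"
    unfolding double[symmetric] by simp
  also have "\<dots> \<le> 4 * p x * p y + 8 * p x * p y"
    by (meson triangle anticommutator_le commutator_le add_mono order_trans)
  finally show ?thesis by simp
qed

lemma dyadic_power_eq: "p (dyadic_power x k) = p x ^ 2 ^ k"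
  by (induction k) (simp_all add: square power_mult[symmetric] mult.commute)

lemma dyadic_power_pred_le: "p (dyadic_power_pred x k) \<le> 6 ^ k * p x ^ (2 ^ Suc k - 1)"
proof (induction k)
  case (Suc k)
  have "p (dyadic_power_pred x (Suc k)) \<le> 6 * p (dyadic_power_pred x k) * p x ^ 2 ^ Suc k"
    unfolding dyadic_power_pred.simps dyadic_power_eq[symmetric] by (rule mult_le_six)
  also have "\<dots> \<le> 6 * (6 ^ k * p x ^ (2 ^ Suc k - 1)) * p x ^ 2 ^ Suc k"
    using Suc by (intro mult_right_mono mult_left_mono) simp_all
  also have "\<dots> = 6 ^ Suc k * p x ^ ((2 ^ Suc k - 1) + 2 ^ Suc k)"
    by (simp only: power_add) simp
  also have "(2 ^ Suc k - 1) + 2 ^ Suc k = (2 ^ Suc (Suc k) - 1 :: nat)"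
    by simp
  finally show ?case .
qed simp

text \<open>Like a spectral radius, \<open>p\<close> cannot tell \<open>(1 + b) a\<close> from
  \<open>a (1 + b)\<close>: by \<open>dyadic_power_add_mult\<close> their powers differ only by
  outer factors, whose constants disappear in the root.\<close>

lemma one_plus_mult_le: "p (a + b * a) \<le> p (a + a * b)"
proof -
  let ?s = "a + b * a" and ?t = "a + a * b"
  define K where "K = 6 * p a * (1 + 6 * p b)"
  have K: "0 \<le> K" by (simp add: K_def)
  have bound: "p ?s ^ 2 ^ Suc k \<le> K * 6 ^ k * p ?t ^ (2 ^ Suc k - 1)" for k
  proof -
    let ?e = "dyadic_power_pred ?t k"
    have "p ?s ^ 2 ^ Suc k = p (?e * a + b * (?e * a))"
      unfolding dyadic_power_eq[symmetric] dyadic_power_add_mult by (simp add: mult.assoc)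
    also have "\<dots> \<le> p (?e * a) + 6 * p b * p (?e * a)"
      by (meson triangle mult_le_six add_left_mono order_trans)
    also have "\<dots> = (1 + 6 * p b) * p (?e * a)"
      by (simp add: algebra_simps)
    also have "\<dots> \<le> (1 + 6 * p b) * (6 * p ?e * p a)"
      by (intro mult_left_mono mult_le_six) simp
    also have "\<dots> = K * p ?e"
      by (simp add: K_def)
    also have "\<dots> \<le> K * (6 ^ k * p ?t ^ (2 ^ Suc k - 1))"
      using K by (intro mult_left_mono dyadic_power_pred_le)
    finally show ?thesis by (simp add: mult.assoc)
  qed
  show ?thesis
  \<comment> \<open>The exponent \<open>2 ^ Suc k - 1\<close> is completed to
    \<open>2 ^ Suc k\<close> by dividing \<open>K\<close> by \<open>p ?t\<close>. The comparison is
    made for squares because the exponents start at \<open>2\<close>.\<close>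
  proof (cases "p ?t = 0")
    case True
    then show ?thesis using bound[of 0] by simp
  next
    case False
    then have "0 < p ?t" using nonneg[of ?t] by linarith
    have "(p ?s)\<^sup>2 \<le> (p ?t)\<^sup>2"
    proof (rule le_of_power_two_power_bound)
      fix k
      have "p ?t ^ 2 ^ Suc k = p ?t * p ?t ^ (2 ^ Suc k - 1)"
        by (simp flip: power_Suc)
      then show "(p ?s)\<^sup>2 ^ 2 ^ k \<le> K / p ?t * 6 ^ k * (p ?t)\<^sup>2 ^ 2 ^ k"
        using bound[of k] \<open>0 < p ?t\<close> by (simp flip: power_mult)
    qed simp_all
    then show ?thesis by simp
  qed
qed

end

section \<open>Cauchy estimates and the vanishing of commutators\<close>

lemma funpow_commute_apply:
  assumes "\<And>z. f (g z) = g (f z)"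
  shows "(f ^^ n) (g z) = g ((f ^^ n) z)"
  by (induction n) (simp_all add: assms)

lemma sum_powers_root_of_unity:
  fixes z :: complex
  assumes "z ^ n = 1"
  shows "(\<Sum>k<n. z ^ k) = (if z = 1 then of_nat n else 0)"
  using assms by (simp add: sum_gp_strict)

context seminormed_algebra
begin

text \<open>Cauchy's estimate for vector-valued polynomials: averaging over the \<open>d\<close>-th roots of unity
  isolates one coefficient.\<close>

lemma coefficient_le:
  assumes "j < d" "0 \<le> r"
    and bound: "\<And>l. cmod l = r \<Longrightarrow> p (\<Sum>i<d. smul (l ^ i) (c i)) \<le> M"
  shows "r ^ j * p (c j) \<le> M"
proof -
  define w where "w = cis (2 * pi / of_nat d)"
  have w_power: "w ^ i = cis (2 * pi * of_nat i / of_nat d)" for i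
    by (simp add: w_def Complex.DeMoivre mult_ac)
  have w: "w ^ d = 1" "cmod w = 1"
    using \<open>j < d\<close> by (simp add: w_power) (simp add: w_def)
  have ww: "cnj w * w = 1"
    using w(2) by (metis complex_norm_square mult.commute of_real_1 one_power2)
  have inj: "inj_on (\<lambda>i. w ^ i) {..<d}"
    using Complex.bij_betw_roots_unity[of d] \<open>j < d\<close> by (simp add: w_power bij_betw_def)
  \<comment> \<open>Orthogonality of the characters of the cyclic group of order \<open>d\<close>:
    the weights \<open>cnj w ^ (j * k)\<close> below annihilate every coefficient except the one at
    \<open>j\<close>.\<close>
  have orth: "(\<Sum>k<d. (cnj w ^ j * w ^ i) ^ k) = (if i = j then of_nat d else 0)" if "i < d" for i
  proof -
    have "cnj w ^ j * w ^ i = 1 \<longleftrightarrow> w ^ i = w ^ j"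
    proof -
      have "cnj w ^ j * w ^ j = 1"
        using ww by (metis power_mult_distrib power_one)
      then show ?thesis
        by (metis mult.commute mult.left_commute mult.right_neutral)
    qed
    then have "cnj w ^ j * w ^ i = 1 \<longleftrightarrow> i = j"
      using inj that \<open>j < d\<close> by (auto simp: inj_on_def)
    moreover have "(cnj w ^ j * w ^ i) ^ d = 1"
      using w(1) by (metis (no_types, opaque_lifting) complex_cnj_one complex_cnj_power mult.commute
        mult_1 power_mult power_mult_distrib power_one)
    ultimately show ?thesis
      by (simp add: sum_powers_root_of_unity)
  qed
  define l where "l k = of_real r * w ^ k" for k
  have coeff: "smul (cnj w ^ (j * k)) (smul (l k ^ i) (c i)) =
      smul ((cnj w ^ j * w ^ i) ^ k) (smul (of_real r ^ i) (c i))" for i k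
    by (simp add: l_def power_mult_distrib power_mult[symmetric] mult_ac)
  have "(\<Sum>k<d. smul (cnj w ^ (j * k)) (\<Sum>i<d. smul (l k ^ i) (c i))) =
      (\<Sum>i<d. smul (\<Sum>k<d. (cnj w ^ j * w ^ i) ^ k) (smul (of_real r ^ i) (c i)))"
    unfolding scale_sum_right scale_sum_left coeff by (rule sum.swap)
  also have "\<dots> = (\<Sum>i<d. if i = j then smul (of_nat d) (smul (of_real r ^ i) (c i)) else 0)"
    by (intro sum.cong refl) (simp add: orth)
  also have "\<dots> = smul (of_nat d * of_real r ^ j) (c j)"
    using \<open>j < d\<close> by simp
  finally have "p (smul (of_nat d * of_real r ^ j) (c j)) \<le>
      (\<Sum>k<d. p (smul (cnj w ^ (j * k)) (\<Sum>i<d. smul (l k ^ i) (c i))))"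
    by (rule subst) (rule sum_le)
  also have "\<dots> \<le> (\<Sum>k<d. M)"
  proof (rule sum_mono)
    fix k
    have "cmod (l k) = r"
      using \<open>0 \<le> r\<close> w(2) by (simp add: l_def norm_mult norm_power)
    then show "p (smul (cnj w ^ (j * k)) (\<Sum>i<d. smul (l k ^ i) (c i))) \<le> M"
      using bound w(2) by (simp add: homogeneous norm_power)
  qed
  finally show ?thesis
    using \<open>0 \<le> r\<close> \<open>j < d\<close> by (simp add: homogeneous norm_mult norm_power)
qed

end

context complex_algebra
begin

text \<open>Applying \<open>1 + l \<phi>\<close> to a polynomial in \<open>l\<close> adds \<phi> of
  the constant coefficient to the linear one. Only these two are tracked, and
  \<open>2 \<le> d'\<close> keeps index \<open>1\<close> in range.\<close>

lemma iterate_one_plus_polynomial: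
  assumes add: "\<And>u v. \<phi> (u + v) = \<phi> u + \<phi> v" and scale: "\<And>t u. \<phi> (smul t u) = smul t (\<phi> u)"
    and F: "\<And>l. F l = (\<Sum>j<d. smul (l ^ j) (c j))" and "2 \<le> d"
  shows "\<exists>d' c'. 2 \<le> d' \<and> c' 0 = c 0 \<and> c' 1 = c 1 + smul (of_nat n) (\<phi> (c 0)) \<and>
    (\<forall>l. ((\<lambda>z. z + smul l (\<phi> z)) ^^ n) (F l) = (\<Sum>j<d'. smul (l ^ j) (c' j)))"
proof (induction n)
  case 0
  then show ?case
    using F \<open>2 \<le> d\<close> by (intro exI[of _ d] exI[of _ c]) simp
next
  case (Suc n)
  then obtain d' c' where *: "2 \<le> d'" "c' 0 = c 0" "c' 1 = c 1 + smul (of_nat n) (\<phi> (c 0))"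
    "\<And>l. ((\<lambda>z. z + smul l (\<phi> z)) ^^ n) (F l) = (\<Sum>j<d'. smul (l ^ j) (c' j))"
    by blast
  have zero: "\<phi> 0 = 0"
    using scale[of 0 0] by simp
  have sum: "\<phi> (sum g I) = (\<Sum>i\<in>I. \<phi> (g i))" for g :: "nat \<Rightarrow> 'a" and I
    by (induction I rule: infinite_finite_induct) (simp_all add: add zero)
  \<comment> \<open>\<open>c'\<close> is arbitrary from index \<open>d'\<close> on and is cut off
    there; the second summand is the shift caused by the factor \<open>l\<close>.\<close>
  define e where "e j = (if j < d' then c' j else 0) + (case j of 0 \<Rightarrow> 0 | Suc i \<Rightarrow> \<phi> (c' i))" for j
  have "((\<lambda>z. z + smul l (\<phi> z)) ^^ Suc n) (F l) = (\<Sum>j<Suc d'. smul (l ^ j) (e j))" for l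
  proof -
    have "(\<Sum>j<Suc d'. smul (l ^ j) (e j)) =
        (\<Sum>j<Suc d'. smul (l ^ j) (if j < d' then c' j else 0)) +
        (\<Sum>j<Suc d'. smul (l ^ j) (case j of 0 \<Rightarrow> 0 | Suc i \<Rightarrow> \<phi> (c' i)))"
      unfolding e_def scale_right_distrib by (rule sum.distrib)
    also have "(\<Sum>j<Suc d'. smul (l ^ j) (if j < d' then c' j else 0)) = (\<Sum>j<d'. smul (l ^ j) (c' j))"
      by simp
    also have "(\<Sum>j<Suc d'. smul (l ^ j) (case j of 0 \<Rightarrow> 0 | Suc i \<Rightarrow> \<phi> (c' i))) =
        smul l (\<phi> (\<Sum>j<d'. smul (l ^ j) (c' j)))"
      by (simp add: sum.lessThan_Suc_shift sum scale scale_sum_right del: sum.lessThan_Suc)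
    finally show ?thesis
      using *(4) by simp
  qed
  moreover have "e 0 = c 0" "e 1 = c 1 + smul (of_nat (Suc n)) (\<phi> (c 0))"
    using * by (simp_all add: e_def scale_left_distrib)
  ultimately show ?case
    using \<open>2 \<le> d'\<close> by (intro exI[of _ "Suc d'"] exI[of _ e]) auto
qed

end

context uniform_seminormed_algebra
begin

text \<open>The Hirschfeld--Zelazko argument. Writing \<open>u = (1 + l y) ^ n\<close> and \<open>v = (1 - l y) ^ n\<close>, one has
  \<open>p (v x u) \<le> p (x u v) = p (x (1 - l\<^sup>2 y\<^sup>2) ^ n)\<close>, which stays bounded on \<open>\<bar>l\<bar> = 1 / sqrt n\<close>, whereas the
  coefficient of \<open>l\<close> in the polynomial \<open>v x u\<close> is \<open>n (x y - y x)\<close>.\<close>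

lemma commutator_eq_zero: "p (x * y - y * x) = 0"
proof -
  \<comment> \<open>The exponential bounds \<open>(1 + 6 (p y)^2 / n)^n\<close> uniformly in
    \<open>n\<close>.\<close>
  define K where "K = p x * exp (6 * (p y)\<^sup>2)"
  have bound: "sqrt n * p (x * y - y * x) \<le> K" if "0 < n" for n :: nat
  proof -
    \<comment> \<open>With a formal unit, \<open>R\<close> is right multiplication by
      \<open>1 + l y\<close>, while \<open>L\<close> and \<open>S\<close> are left and right
      multiplication by \<open>1 - l y\<close>. Since \<open>S\<close> commutes with
      \<open>L\<close>, the factors \<open>L\<close> can be exchanged for \<open>S\<close> one at a
      time by \<open>one_plus_mult_le\<close>.\<close>
    define R where "R l z = z + smul l (z * y)" for l z
    define L where "L l z = z + smul l (- (y * z))" for l z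
    define S where "S l z = z + smul l (- (z * y))" for l z
    note distribs = algebra_simps smul_mult_left smul_mult_right
    have LS: "L l (S l z) = S l (L l z)" and SR: "S l (R l z) = R l (S l z)"
      and SR_eq: "S l (R l z) = z - smul (l\<^sup>2) (z * (y * y))" for l z
      by (simp_all add: L_def S_def R_def distribs power2_eq_square)
    have "p (L l z) \<le> p (S l z)" for l z
      using one_plus_mult_le[of z "smul (- l) y"]
      by (simp add: L_def S_def smul_mult_left smul_mult_right)
    then have LS_le: "p ((L l ^^ n) z) \<le> p ((S l ^^ n) z)" for l z n
    proof (induction n arbitrary: z)
      case (Suc n)
      have "p ((L l ^^ Suc n) z) \<le> p (S l ((L l ^^ n) z))"
        using Suc.prems by simp
      also have "\<dots> = p ((L l ^^ n) (S l z))"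
        by (simp add: funpow_commute_apply[of "L l" "S l", OF LS])
      also have "\<dots> \<le> p ((S l ^^ n) (S l z))"
        by (rule Suc.IH[OF Suc.prems])
      finally show ?case
        by (simp add: funpow_swap1)
    qed simp
    \<comment> \<open>At radius \<open>1 / sqrt n\<close> each of the \<open>n\<close> factors costs
      only \<open>1 + O(1 / n)\<close>, while the linear coefficient is still weighted by
      \<open>n / sqrt n = sqrt n\<close>.\<close>
    have SR_le: "p (S l (R l z)) \<le> (1 + 6 * (p y)\<^sup>2 / n) * p z" if "cmod l = 1 / sqrt n" for l z
    proof -
      have "p (S l (R l z)) \<le> p z + p (smul (l\<^sup>2) (z * (y * y)))"
        unfolding SR_eq by (rule triangle_diff)
      also have "\<dots> = p z + 1 / n * p (z * (y * y))"
        using that by (simp add: homogeneous norm_power power_divide)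
      also have "\<dots> \<le> p z + 1 / n * (6 * p z * p (y * y))"
        by (intro add_left_mono mult_left_mono mult_le_six) simp
      finally show ?thesis
        by (simp add: square algebra_simps)
    qed
    have SnRn: "p ((S l ^^ m) ((R l ^^ m) x)) \<le> (1 + 6 * (p y)\<^sup>2 / n) ^ m * p x"
      if "cmod l = 1 / sqrt n" for l m
    proof (induction m)
      case (Suc m)
      have "(S l ^^ Suc m) ((R l ^^ Suc m) x) = S l (R l ((S l ^^ m) ((R l ^^ m) x)))"
        by (simp add: funpow_commute_apply[of "S l" "R l", OF SR])
      then have "p ((S l ^^ Suc m) ((R l ^^ Suc m) x)) \<le>
          (1 + 6 * (p y)\<^sup>2 / n) * p ((S l ^^ m) ((R l ^^ m) x))"
        using SR_le[OF that] by simp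
      also have "\<dots> \<le> (1 + 6 * (p y)\<^sup>2 / n) * ((1 + 6 * (p y)\<^sup>2 / n) ^ m * p x)"
        using Suc by (intro mult_left_mono) simp_all
      finally show ?case by (simp add: mult.assoc)
    qed simp
    obtain d1 c1 where 1: "2 \<le> d1" "c1 0 = x" "c1 1 = smul (of_nat n) (x * y)"
      "\<And>l. (R l ^^ n) x = (\<Sum>j<d1. smul (l ^ j) (c1 j))"
      using iterate_one_plus_polynomial[where \<phi> = "\<lambda>z. z * y" and F = "\<lambda>_. x" and d = 2 and n = n
          and c = "\<lambda>j. if j = 0 then x else 0"]
      by (auto simp: R_def[abs_def] distribs numeral_2_eq_2)
    obtain d2 c2 where 2: "2 \<le> d2" "c2 0 = x" "c2 1 = smul (of_nat n) (x * y) + smul (of_nat n) (- (y * x))"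
      "\<And>l. (L l ^^ n) ((R l ^^ n) x) = (\<Sum>j<d2. smul (l ^ j) (c2 j))"
      using iterate_one_plus_polynomial[where \<phi> = "\<lambda>z. - (y * z)" and F = "\<lambda>l. (R l ^^ n) x"
          and d = d1 and n = n and c = c1, OF _ _ 1(4) 1(1)]
      by (auto simp: L_def[abs_def] distribs 1(2,3)[simplified])
    have "(1 / sqrt n) ^ 1 * p (c2 1) \<le> K"
    proof (rule coefficient_le)
      fix l
      assume l: "cmod l = 1 / sqrt n"
      have "p (\<Sum>j<d2. smul (l ^ j) (c2 j)) \<le> p ((S l ^^ n) ((R l ^^ n) x))"
        using LS_le by (simp flip: 2(4))
      also have "\<dots> \<le> (1 + 6 * (p y)\<^sup>2 / n) ^ n * p x"
        by (rule SnRn[OF l])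
      also have "\<dots> \<le> exp (6 * (p y)\<^sup>2) * p x"
        using \<open>0 < n\<close> by (intro mult_right_mono exp_ge_one_plus_x_over_n_power_n) (simp_all add: order_trans[of _ 0])
      finally show "p (\<Sum>j<d2. smul (l ^ j) (c2 j)) \<le> K"
        by (simp add: K_def mult.commute)
    qed (use 2 in simp_all)
    moreover have "c2 1 = smul (of_nat n) (x * y - y * x)"
      using 2(3) by (simp add: scale_right_diff_distrib)
    ultimately have "n / sqrt n * p (x * y - y * x) \<le> K"
      by (simp add: homogeneous)
    then show ?thesis
      by (simp add: real_div_sqrt)
  qed
  \<comment> \<open>Squaring makes the growth linear in \<open>n\<close>, so that the Archimedean
    property applies.\<close>
  have "of_nat n * (p (x * y - y * x))\<^sup>2 \<le> K\<^sup>2" for n :: nat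
  proof (cases "0 < n")
    case True
    have "(sqrt n * p (x * y - y * x))\<^sup>2 \<le> K\<^sup>2"
      using bound[OF True] by (intro power_mono) simp_all
    then show ?thesis by (simp add: power_mult_distrib)
  qed simp
  then show ?thesis
    by (metis linorder_not_less reals_Archimedean3 zero_eq_power2 zero_le_power2 antisym_conv2)
qed

end

section \<open>Minimal uniform seminorms on commutative algebras\<close>

lemma dyadic_power_mult:
  fixes x y :: "'a::semigroup_mult"
  assumes commute: "\<And>x y :: 'a. x * y = y * x"
  shows "dyadic_power (x * y) k = dyadic_power x k * dyadic_power y k"
proof (induction k)
  case (Suc k)
  then show ?case
    by simp (metis commute mult.assoc)
qed simp

locale commutative_uniform_seminormed_algebra = uniform_seminormed_algebra smul p
  for smul :: "complex \<Rightarrow> 'a::ring \<Rightarrow> 'a" and p :: "'a \<Rightarrow> real" +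
  assumes commute: "(x::'a) * y = y * x"
begin

text \<open>Powers of a product now split, so the constant \<open>6\<close> enters once for every
  \<open>k\<close> and is lost in the root.\<close>

lemma mult_le: "p (x * y) \<le> p x * p y"
proof (rule le_of_power_two_power_bound)
  fix k
  have "p (x * y) ^ 2 ^ k \<le> 6 * p (dyadic_power x k) * p (dyadic_power y k)"
    unfolding dyadic_power_eq[symmetric] dyadic_power_mult[OF commute] by (rule mult_le_six)
  then show "p (x * y) ^ 2 ^ k \<le> 6 * 1 ^ k * (p x * p y) ^ 2 ^ k"
    by (simp add: dyadic_power_eq power_mult_distrib)
qed simp_all

end

context complex_algebra
begin

text \<open>This serves both chains of uniform seminorms and localizations; in the latter, squaring
  changes the index, hence the free index \<open>j\<close> in \<open>le\<close> and
  \<open>ge\<close>. Directedness yields the triangle inequality.\<close>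

lemma uniform_seminorm_INF:
  fixes g :: "'i \<Rightarrow> 'a \<Rightarrow> real"
  assumes "I \<noteq> {}" and seminorm: "\<And>i. i \<in> I \<Longrightarrow> seminorm smul (g i)"
    and directed: "\<And>i j. i \<in> I \<Longrightarrow> j \<in> I \<Longrightarrow> \<exists>k\<in>I. g k \<le> g i \<and> g k \<le> g j"
    and le: "\<And>i z. i \<in> I \<Longrightarrow> \<exists>j\<in>I. g j (z * z) \<le> (g i z)\<^sup>2"
    and ge: "\<And>i z. i \<in> I \<Longrightarrow> \<exists>j\<in>I. (g j z)\<^sup>2 \<le> g i (z * z)"
  shows "uniform_seminorm smul (\<lambda>z. INF i\<in>I. g i z)"
proof -
  define u where "u z = (INF i\<in>I. g i z)" for z
  have g: "0 \<le> g i z" "g i (y + z) \<le> g i y + g i z" "g i (smul c z) = cmod c * g i z"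
    if "i \<in> I" for i y z c
    using seminorm[OF that] by (auto simp: seminorm_def)
  have lower: "u z \<le> g i z" if "i \<in> I" for i z
    unfolding u_def using g(1) that by (intro cINF_lower bdd_belowI2[of _ 0])
  have greatest: "m \<le> u z" if "\<And>i. i \<in> I \<Longrightarrow> m \<le> g i z" for m z
    unfolding u_def using that \<open>I \<noteq> {}\<close> by (rule cINF_greatest[rotated])
  have nonneg: "0 \<le> u z" for z
    using g(1) by (rule greatest)
  have triangle: "u (y + z) \<le> u y + u z" for y z
  proof -
    have "u (y + z) - g i y \<le> g j z" if "i \<in> I" "j \<in> I" for i j
    proof -
      obtain k where k: "k \<in> I" "g k y \<le> g i y" "g k z \<le> g j z"
        using \<open>i \<in> I\<close> \<open>j \<in> I\<close> directed by (meson le_funD)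
      show ?thesis
        using lower[OF k(1), of "y + z"] g(2)[OF k(1), of y z] k(2,3) by linarith
    qed
    then have "u (y + z) - g i y \<le> u z" if "i \<in> I" for i
      using that by (intro greatest)
    then have "u (y + z) - u z \<le> g i y" if "i \<in> I" for i
      using that by (simp add: algebra_simps)
    then have "u (y + z) - u z \<le> u y"
      by (rule greatest)
    then show ?thesis by simp
  qed
  have homogeneous_ge: "cmod c * u z \<le> u (smul c z)" for c z
    using g lower by (intro greatest) (simp add: mult_left_mono)
  have homogeneous: "u (smul c z) = cmod c * u z" for c z
  proof (cases "c = 0")
    case True
    then show ?thesis
      using lower[of _ 0] g(3)[of _ 0 0] nonneg[of 0] \<open>I \<noteq> {}\<close> by fastforce
  next
    case False
    then show ?thesis
      using homogeneous_ge[of c z] homogeneous_ge[of "inverse c" "smul c z"]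
      by (simp add: norm_divide field_simps)
  qed
  have "u (z * z) \<le> (u z)\<^sup>2" for z
  proof -
    \<comment> \<open>Taking the root gives a lower bound of all \<open>g i z\<close>, to which the
      infimum property applies.\<close>
    have "sqrt (u (z * z)) \<le> g i z" if "i \<in> I" for i
    proof -
      have "u (z * z) \<le> (g i z)\<^sup>2"
        using le[OF that, of z] lower by (meson order_trans)
      then show ?thesis
        using g(1)[OF that] by (simp add: real_le_lsqrt)
    qed
    then have "sqrt (u (z * z)) \<le> u z"
      by (rule greatest)
    then show ?thesis
      by (simp add: sqrt_le_D)
  qed
  moreover have "(u z)\<^sup>2 \<le> u (z * z)" for z
  proof (rule greatest)
    fix i
    assume "i \<in> I"
    then obtain j where "j \<in> I" "(g j z)\<^sup>2 \<le> g i (z * z)"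
      using ge by blast
    then show "(u z)\<^sup>2 \<le> g i (z * z)"
      using power_mono[OF lower nonneg] by (meson order_trans)
  qed
  ultimately have "u (z * z) = (u z)\<^sup>2" for z
    by (simp add: antisym)
  then show ?thesis
    unfolding u_def[symmetric] uniform_seminorm_def seminorm_def
    using nonneg triangle homogeneous by blast
qed

text \<open>Zorn's lemma: the infimum of a nonempty chain stays uniform and keeps the value
  \<open>1\<close> at \<open>x\<close>, where all members equal \<open>1\<close>.\<close>

lemma exists_minimal_uniform_seminorm:
  assumes "uniform_seminorm smul p" "p x = 1"
  obtains q where "uniform_seminorm smul q" "q x = 1"
    "\<And>r. uniform_seminorm smul r \<Longrightarrow> r x = 1 \<Longrightarrow> r \<le> q \<Longrightarrow> r = q"
proof -
  define Q where "Q = {q. uniform_seminorm smul q \<and> q x = 1}"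
  \<comment> \<open>The order is reversed, so that Zorn's maximal element is a minimal
    seminorm.\<close>
  let ?R = "relation_of (\<lambda>q r. r \<le> q) Q"
  have "\<exists>m\<in>Q. \<forall>r\<in>Q. r \<le> m \<longrightarrow> r = m"
  proof (rule predicate_Zorn)
    show "partial_order_on Q ?R"
      by (auto simp: partial_order_on_def preorder_on_def refl_on_def trans_def antisym_def relation_of_def)
    fix C
    assume "C \<in> Chains ?R"
    then have C: "C \<subseteq> Q" and chain: "\<And>q r. q \<in> C \<Longrightarrow> r \<in> C \<Longrightarrow> q \<le> r \<or> r \<le> q"
      by (auto simp: Chains_def relation_of_def)
    show "\<exists>u\<in>Q. \<forall>q\<in>C. u \<le> q"
    proof (cases "C = {}")
      case True
      then show ?thesis
        using assms by (auto simp: Q_def)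
    next
      case False
      define u where "u z = (INF q\<in>C. q z)" for z
      have uniform: "uniform_seminorm smul q" "q x = 1" if "q \<in> C" for q
        using that C by (auto simp: Q_def)
      then have square: "q (z * z) = (q z)\<^sup>2" and nonneg: "0 \<le> q z" if "q \<in> C" for q z
        using that by (auto simp: uniform_seminorm_def seminorm_def)
      have "uniform_seminorm smul u"
        unfolding u_def
      proof (rule uniform_seminorm_INF)
        show "\<exists>k\<in>C. k \<le> q \<and> k \<le> r" if "q \<in> C" "r \<in> C" for q r
          using chain[OF that] that by blast
      qed (use False uniform square in \<open>auto simp: uniform_seminorm_def\<close>)
      moreover have "u x = 1"
      proof -
        have "u x = (INF q\<in>C. 1)"
          unfolding u_def using uniform(2) by (rule INF_cong[OF refl])
        then show ?thesis
          using False by simp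
      qed
      moreover have "u \<le> q" if "q \<in> C" for q
        unfolding u_def using that nonneg by (intro le_funI cINF_lower bdd_belowI2[of _ 0])
      ultimately show ?thesis
        by (auto simp: Q_def)
    qed
  qed
  then show thesis
    using that by (auto simp: Q_def)
qed

end

context commutative_uniform_seminormed_algebra
begin

lemma left_commute: "(x::'a) * (y * z) = y * (x * z)"
  by (simp only: mult.assoc[symmetric] commute[of x y])

text \<open>The localization \<open>z \<mapsto> inf\<^sub>k p (y ^ k z) / p y ^ k\<close> of \<open>p\<close> at \<open>y\<close>, along the exponents \<open>2 ^ k\<close>,
  is a uniform seminorm below \<open>p\<close>; so it is \<open>p\<close> itself as soon as its value at \<open>x\<close> is still \<open>1\<close>.\<close>

lemma mult_eq_by_localization:
  assumes minimal: "\<And>r. uniform_seminorm smul r \<Longrightarrow> r x = 1 \<Longrightarrow> r \<le> p \<Longrightarrow> r = p"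
    and pos: "0 < p y" and x: "\<And>k. p (dyadic_power y k * x) = p y ^ 2 ^ k"
  shows "p (y * z) = p y * p z"
proof -
  define g where "g k z = p (dyadic_power y k * z) / p y ^ 2 ^ k" for k :: nat and z
  define r where "r z = (INF k. g k z)" for z
  have Suc_le: "g (Suc k) z \<le> g k z" for k z
  proof -
    have "p (dyadic_power y (Suc k) * z) \<le> p y ^ 2 ^ k * p (dyadic_power y k * z)"
      using mult_le[of "dyadic_power y k" "dyadic_power y k * z"] by (simp add: dyadic_power_eq mult.assoc)
    then show ?thesis
      using pos by (simp add: g_def mult_2 power_add field_simps)
  qed
  then have decreasing: "g k z \<le> g j z" if "j \<le> k" for j k z
    using that by (rule lift_Suc_antimono_le[of "\<lambda>k. g k z"])
  \<comment> \<open>Squaring raises the index by one, which is why the exponents are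
    \<open>2 ^ k\<close>. One half of the square property of \<open>r\<close> is this equation, the
    other combines it with \<open>Suc_le\<close>.\<close>
  have square: "g (Suc k) (z * z) = (g k z)\<^sup>2" for k z
  proof -
    have "dyadic_power y (Suc k) * (z * z) = (dyadic_power y k * z) * (dyadic_power y k * z)"
      by (simp add: mult.assoc left_commute)
    then show ?thesis
      by (simp add: g_def square power_divide flip: power_mult) (simp add: mult.commute)
  qed
  have lower: "r z \<le> g k z" for k z
    unfolding r_def using pos by (intro cINF_lower bdd_belowI2[of _ 0]) (simp_all add: g_def)
  have "uniform_seminorm smul r"
    unfolding r_def
  proof (rule uniform_seminorm_INF)
    show "seminorm smul (g k)" for k
      unfolding seminorm_def g_def
      using pos triangle by (auto simp: smul_mult_right homogeneous distrib_left add_divide_distrib[symmetric] divide_right_mono)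
    show "\<exists>l\<in>UNIV. g l \<le> g i \<and> g l \<le> g j" for i j
      using decreasing by (intro bexI[of _ "max i j"]) (auto intro!: le_funI)
    show "\<exists>j\<in>UNIV. g j (z * z) \<le> (g i z)\<^sup>2" for i z
      using square by (metis UNIV_I order_refl)
    show "\<exists>j\<in>UNIV. (g j z)\<^sup>2 \<le> g i (z * z)" for i z
      using square Suc_le by (metis UNIV_I)
  qed simp
  moreover have "r x = 1"
    using x pos by (simp add: r_def g_def)
  moreover have g0: "g 0 z = p (y * z) / p y" for z
    by (simp add: g_def)
  have "g 0 z \<le> p z" for z
    using mult_le[of y z] pos by (simp add: g0 field_simps)
  then have "r \<le> p"
    using lower by (meson le_funI order_trans)
  ultimately have "r = p"
    using minimal by blast
  \<comment> \<open>\<open>r = p\<close> lies below \<open>g 0\<close>: this is the half of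
    multiplicativity that \<open>mult_le\<close> does not give.\<close>
  then have "p z \<le> p (y * z) / p y"
    using lower[of z 0] g0 by simp
  then show ?thesis
    using mult_le[of y z] pos by (simp add: field_simps)
qed

text \<open>Localizing at \<open>x\<close> itself gives \<open>p (x * z) = p z\<close>. Hence
  localizing at any \<open>y\<close> with \<open>p y > 0\<close> also keeps the value
  \<open>1\<close> at \<open>x\<close>.\<close>

lemma mult_eq_if_minimal:
  assumes x: "p x = 1"
    and minimal: "\<And>r. uniform_seminorm smul r \<Longrightarrow> r x = 1 \<Longrightarrow> r \<le> p \<Longrightarrow> r = p"
  shows "p (y * z) = p y * p z"
proof -
  have x_mult: "p (x * z) = p z" for z
  proof -
    have "p (dyadic_power x k * x) = p x ^ 2 ^ k" for k
    proof -
      let ?w = "dyadic_power x k"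
      \<comment> \<open>Each squaring of the right factor costs
        \<open>p (dyadic_power x j) = 1\<close>. At \<open>j = k\<close> the left side is
        \<open>p (?w * ?w) = 1\<close>.\<close>
      have "p (?w * dyadic_power x j) \<le> p (?w * x)" for j
      proof (induction j)
        case (Suc j)
        have "p (?w * dyadic_power x (Suc j)) \<le> p (?w * dyadic_power x j) * p (dyadic_power x j)"
          using mult_le[of "?w * dyadic_power x j" "dyadic_power x j"] by (simp add: mult.assoc)
        with Suc show ?case
          by (simp only: dyadic_power_eq x) simp
      qed simp
      from this[of k] have "1 \<le> p (?w * x)"
        by (simp add: square dyadic_power_eq x)
      moreover have "p (?w * x) \<le> 1"
        using mult_le[of ?w x] by (simp add: dyadic_power_eq x)
      ultimately show ?thesis
        by (simp add: x)
    qed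
    then show ?thesis
      using mult_eq_by_localization[where x = x and y = x and z = z, OF minimal] x by simp
  qed
  show ?thesis
  proof (cases "p y = 0")
    case True
    then show ?thesis
      using mult_le[of y z] nonneg[of "y * z"] by simp
  next
    case False
    then have "0 < p y"
      using nonneg[of y] by linarith
    moreover have "p (dyadic_power y k * x) = p y ^ 2 ^ k" for k
      using x_mult by (simp add: commute[of _ x] dyadic_power_eq)
    ultimately show ?thesis
      using mult_eq_by_localization[OF minimal] by blast
  qed
qed

end

section \<open>Characters from multiplicative seminorms\<close>

locale multiplicative_seminormed_algebra = seminormed_algebra smul p
  for smul :: "complex \<Rightarrow> 'a::ring \<Rightarrow> 'a" and p :: "'a \<Rightarrow> real" +
  assumes commute: "(x::'a) * y = y * x"
    and mult: "p (x * y) = p x * p y"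
begin

lemma dyadic_power_eq: "p (dyadic_power x k) = p x ^ 2 ^ k"
  by (induction k) (simp_all add: mult mult_2 power_add)

text \<open>Ostrowski's argument: \<open>N l = p (a x - l x)\<close> attains its minimum \<open>m\<close>, and if \<open>m > 0\<close> then the
  factorization of \<open>b ^ 2 ^ k - \<nu> ^ 2 ^ k\<close>, where \<open>b = a - l\<close>, shows that the set where \<open>N = m\<close> is open.\<close>

lemma Gelfand_Mazur:
  assumes x: "p x = 1"
  shows "\<exists>l. p (a * x - smul l x) = 0"
proof (rule ccontr)
  assume nonzero: "\<nexists>l. p (a * x - smul l x) = 0"
  \<comment> \<open>Here \<open>x\<close> plays the part of the unit: \<open>N l\<close> measures
    \<open>(a - l) x\<close>.\<close>
  define N where "N l = p (a * x - smul l x)" for l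
  have N_diff: "N l - N l' \<le> dist l l'" for l l'
  proof -
    have "(a * x - smul l x) - (a * x - smul l' x) = smul (l' - l) x"
      by (simp add: scale_left_diff_distrib)
    then show ?thesis
      using diff_le[of "a * x - smul l x" "a * x - smul l' x"] x
      by (simp add: N_def homogeneous dist_norm norm_minus_commute)
  qed
  have "dist (N l) (N l') \<le> dist l l'" for l l'
    using N_diff[of l l'] N_diff[of l' l] by (simp add: dist_real_def dist_commute abs_le_iff)
  then have cont: "continuous_on A N" for A
    unfolding continuous_on_iff by (meson order_le_less_trans)
  have growth: "cmod l - N 0 \<le> N l" for l
    using diff_le[of "smul l x" "a * x"] minus[of "a * x - smul l x"] x
    by (simp add: N_def homogeneous)
  have "0 \<le> N 0"
    by (simp add: N_def)
  \<comment> \<open>By \<open>growth\<close>, \<open>N l\<close> exceeds \<open>N 0\<close> outside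
    this disc, so the minimum on the disc is global.\<close>
  have "\<exists>l0\<in>cball 0 (2 * N 0). \<forall>l\<in>cball 0 (2 * N 0). N l0 \<le> N l"
    using cont \<open>0 \<le> N 0\<close> by (intro continuous_attains_inf) auto
  then obtain l0 where "\<forall>l\<in>cball 0 (2 * N 0). N l0 \<le> N l"
    by blast
  then have l0: "N l0 \<le> N l" if "cmod l \<le> 2 * N 0" for l
    using that by simp
  define m where "m = N l0"
  have m_le: "m \<le> N l" for l
    using l0[of l] l0[of 0] growth[of l] \<open>0 \<le> N 0\<close> unfolding m_def by fastforce
  have "0 < m"
    using nonzero nonneg unfolding m_def N_def by (metis order_le_less)
  have N_add: "N (l + \<nu>) = m" if "N l = m" "cmod \<nu> < m" for l \<nu>
  proof -
    define b where "b = a * x - smul l x"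
    have b: "p b = m"
      using \<open>N l = m\<close> by (simp add: N_def b_def)
    define D where "D k \<nu> = dyadic_power b k - smul (\<nu> ^ 2 ^ k) (dyadic_power x k)" for k :: nat and \<nu>
    \<comment> \<open>In effect \<open>p (D k \<nu>)\<close> is at least
      \<open>N (l + \<nu>) * m ^ (2 ^ k - 1)\<close>, because every other linear factor contributes
      at least \<open>m\<close>; the factor \<open>m\<close> on the right avoids subtracting in the
      exponent.\<close>
    have lower: "N (l + \<nu>) * m ^ 2 ^ k \<le> p (D k \<nu>) * m" for k \<nu>
    proof (induction k arbitrary: \<nu>)
      case 0
      show ?case
        by (simp add: D_def N_def b_def scale_left_distrib diff_diff_eq)
    next
      case (Suc k)
      \<comment> \<open>This root makes the cofactor \<open>b ^ 2 ^ k + \<nu> ^ 2 ^ k\<close>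
        another \<open>D k \<sigma>\<close>, so the induction hypothesis covers both
        factors.\<close>
      obtain \<sigma> where \<sigma>: "\<sigma> ^ 2 ^ k = - (\<nu> ^ 2 ^ k)"
        using exists_complex_root[of "2 ^ k" "- (\<nu> ^ 2 ^ k)"] by (metis power_not_zero zero_neq_numeral)
      have "D (Suc k) \<nu> = D k \<nu> * D k \<sigma>"
        by (simp add: D_def \<sigma> mult_2 power_add algebra_simps smul_mult_left smul_mult_right
            commute[of "dyadic_power x k" "dyadic_power b k"])
      then have D: "p (D (Suc k) \<nu>) = p (D k \<nu>) * p (D k \<sigma>)"
        by (simp add: mult)
      have "m * m ^ 2 ^ k \<le> N (l + \<sigma>) * m ^ 2 ^ k"
        using m_le \<open>0 < m\<close> by (intro mult_right_mono) simp_all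
      also have "\<dots> \<le> p (D k \<sigma>) * m"
        by (rule Suc)
      finally have "m ^ 2 ^ k \<le> p (D k \<sigma>)"
        using \<open>0 < m\<close> by (simp add: mult.commute)
      then have "(N (l + \<nu>) * m ^ 2 ^ k) * m ^ 2 ^ k \<le> (p (D k \<nu>) * m) * p (D k \<sigma>)"
        using Suc[of \<nu>] \<open>0 < m\<close> by (auto intro!: mult_mono[of _ _ _ "p (D k \<sigma>)"])
      then show ?case
        by (simp add: D mult_2 power_add mult_ac)
    qed
    have "N (l + \<nu>) \<le> m * (1 + (cmod \<nu> / m) ^ 2 ^ k)" for k
    proof -
      have "p (D k \<nu>) \<le> m ^ 2 ^ k + cmod \<nu> ^ 2 ^ k"
        unfolding D_def
        using triangle_diff[of "dyadic_power b k" "smul (\<nu> ^ 2 ^ k) (dyadic_power x k)"]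
        by (simp add: homogeneous norm_power dyadic_power_eq x b)
      then have "N (l + \<nu>) * m ^ 2 ^ k \<le> (m ^ 2 ^ k + cmod \<nu> ^ 2 ^ k) * m"
        using lower[of \<nu> k] \<open>0 < m\<close> by (meson mult_right_mono order_less_imp_le order_trans)
      then show ?thesis
        using \<open>0 < m\<close> by (simp add: power_divide field_simps)
    qed
    moreover have "(\<lambda>k. (cmod \<nu> / m) ^ 2 ^ k) \<longlonglongrightarrow> 0"
    proof -
      have "(\<lambda>n. (cmod \<nu> / m) ^ n) \<longlonglongrightarrow> 0"
        using that \<open>0 < m\<close> by (intro LIMSEQ_power_zero) simp
      moreover have "filterlim (\<lambda>k::nat. 2 ^ k :: nat) sequentially sequentially"
        by (intro filterlim_subseq) (simp add: strict_mono_def)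
      ultimately show ?thesis
        by (rule filterlim_compose)
    qed
    then have "(\<lambda>k. m * (1 + (cmod \<nu> / m) ^ 2 ^ k)) \<longlonglongrightarrow> m"
      by (auto intro!: tendsto_eq_intros)
    ultimately have "N (l + \<nu>) \<le> m"
      by (intro LIMSEQ_le_const) auto
    then show ?thesis
      using m_le by (simp add: antisym)
  qed
  have "open {l. N l = m}"
    unfolding open_contains_ball
  proof (intro ballI exI conjI subsetI)
    fix l l'
    assume "l \<in> {l. N l = m}" "l' \<in> ball l m"
    then show "l' \<in> {l. N l = m}"
      using N_add[of l "l' - l"] by (simp add: dist_norm norm_minus_commute)
  qed (rule \<open>0 < m\<close>)
  moreover have "closed {l. N l = m}"
    using cont by (intro closed_Collect_eq) auto
  moreover have "l0 \<in> {l. N l = m}"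
    by (simp add: m_def)
  \<comment> \<open>The plane is connected, so \<open>N\<close> would be constant, against
    \<open>growth\<close>.\<close>
  ultimately have "{l. N l = m} = UNIV"
    by (metis clopen empty_iff)
  then have "N (of_real (N 0 + m + 1)) = m"
    by blast
  then show False
    using growth[of "of_real (N 0 + m + 1)"] \<open>0 < m\<close> \<open>0 \<le> N 0\<close> by (simp del: of_real_add)
qed

text \<open>Modulo the kernel of \<open>p\<close>, each \<open>a\<close> multiplies \<open>x\<close>
  by a scalar \<open>f a\<close>. Uniqueness of this scalar makes \<open>f\<close> linear and
  multiplicative.\<close>

lemma exists_character:
  assumes x: "p x = 1"
  shows "\<exists>f\<in>characters smul. cmod (f x) = 1"
proof -
  obtain f where f: "\<And>a. p (a * x - smul (f a) x) = 0"
    using Gelfand_Mazur[OF x] by metis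
  have unique: "f a = l" if "p (a * x - smul l x) = 0" for a l
  proof -
    have "smul (f a - l) x = (a * x - smul l x) - (a * x - smul (f a) x)"
      by (simp add: scale_left_diff_distrib)
    then have "cmod (f a - l) = 0"
      using triangle_diff[of "a * x - smul l x" "a * x - smul (f a) x"] f[of a] that x
      by (metis add_0 homogeneous mult.right_neutral norm_ge_zero order_antisym)
    then show ?thesis by simp
  qed
  have null_add: "p (u + v) = 0" if "p u = 0" "p v = 0" for u v
    using triangle[of u v] nonneg[of "u + v"] that by simp
  have add: "f (a + b) = f a + f b" for a b
  proof (rule unique)
    have "(a + b) * x - smul (f a + f b) x = (a * x - smul (f a) x) + (b * x - smul (f b) x)"
      by (simp add: algebra_simps)
    then show "p ((a + b) * x - smul (f a + f b) x) = 0"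
      using f null_add by simp
  qed
  have scale: "f (smul c a) = c * f a" for c a
  proof (rule unique)
    have "smul c a * x - smul (c * f a) x = smul c (a * x - smul (f a) x)"
      by (simp add: algebra_simps smul_mult_left)
    then show "p (smul c a * x - smul (c * f a) x) = 0"
      using f by (simp add: homogeneous)
  qed
  have times: "f (a * b) = f a * f b" for a b
  proof (rule unique)
    have "a * b * x - smul (f a * f b) x = a * (b * x - smul (f b) x) + smul (f b) (a * x - smul (f a) x)"
      by (simp add: algebra_simps smul_mult_right)
    then show "p (a * b * x - smul (f a * f b) x) = 0"
      using f null_add by (simp add: mult homogeneous)
  qed
  \<comment> \<open>Take \<open>a = x\<close> and compare \<open>p (x * x) = 1\<close> with
    \<open>p (smul (f x) x)\<close>.\<close>
  have norm: "cmod (f x) = 1"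
    using eq_of_diff_zero[OF f[of x]] x by (simp add: mult homogeneous)
  have "vector_space ((*) :: complex \<Rightarrow> complex \<Rightarrow> complex)"
    by unfold_locales (simp_all add: algebra_simps)
  then have "Vector_Spaces.linear smul (*) f"
    unfolding Vector_Spaces.linear_iff using add scale vector_space_axioms by blast
  then have "f \<in> characters smul"
    using times norm by (auto simp: characters_def)
  then show ?thesis
    using norm by blast
qed

end

section \<open>Topological algebras\<close>

text \<open>Semiballs cannot separate \<open>z\<close> from \<open>0\<close>, since
  \<open>p (z - x) = p (- x)\<close>. This passes to all generated open sets and contradicts
  separation of points.\<close>

lemma eq_zero_of_determines_topology:
  fixes P :: "('a::{ring, t2_space, topological_ab_group_add} \<Rightarrow> real) set"
  assumes "determines_topology P" and symmetric: "\<And>p x. p \<in> P \<Longrightarrow> p (- x) = p x"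
    and triangle: "\<And>p x y. p \<in> P \<Longrightarrow> p (x + y) \<le> p x + p y"
    and zero: "\<And>p. p \<in> P \<Longrightarrow> p z = 0"
  shows "z = 0"
proof (rule ccontr)
  assume "z \<noteq> 0"
  then obtain U where U: "open U" "z \<in> U" "0 \<notin> U"
    using t1_space by blast
  have "generate_topology {{y. p (y - x) < r} |p x r. p \<in> P \<and> 0 < r} U"
    using assms(1) U(1) by (simp add: determines_topology_def)
  then have "z \<in> U \<longleftrightarrow> 0 \<in> U"
  proof (induction rule: generate_topology.induct)
    case (Basis S)
    then obtain p x r where p: "p \<in> P" and S: "S = {y. p (y - x) < r}"
      by blast
    have "p (z - x) = p (- x)"
      using triangle[OF p, of z "- x"] triangle[OF p, of "- z" "z - x"] symmetric[OF p, of z] zero[OF p]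
      by simp
    then show ?case
      by (simp add: S)
  qed auto
  with U show False by simp
qed

lemma property_P_if_uniform:
  fixes smul :: "complex \<Rightarrow> 'a::{ring, t2_space, topological_ab_group_add} \<Rightarrow> 'a"
  assumes "(UNIV :: 'a set) \<noteq> {0}" "uniform_topological_algebra smul"
  shows "property_P smul"
proof -
  from assms(2) obtain P where "topological_algebra smul"
    and uniform: "\<And>p. p \<in> P \<Longrightarrow> uniform_seminorm smul p" and P: "determines_topology P"
    by (auto simp: uniform_topological_algebra_def)
  interpret topological_algebra smul by fact
  have uniform_algebra: "uniform_seminormed_algebra smul p" if "uniform_seminorm smul p" for p
    using that by unfold_locales (simp_all add: uniform_seminorm_def)
  have eq_zero: "z = 0" if "\<And>p. p \<in> P \<Longrightarrow> p z = 0" for z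
  proof (rule eq_zero_of_determines_topology[OF P])
    fix p x y
    assume "p \<in> P"
    then interpret uniform_seminormed_algebra smul p
      using uniform_algebra uniform by blast
    show "p (- x) = p x" "p (x + y) \<le> p x + p y" "p z = 0"
      using that \<open>p \<in> P\<close> by (simp_all add: triangle)
  qed
  \<comment> \<open>Every commutator is annihilated by all of \<open>P\<close>, and \<open>P\<close>
    separates points.\<close>
  have commute: "x * y = y * x" for x y :: 'a
    using eq_zero[of "x * y - y * x"] uniform_algebra uniform uniform_seminormed_algebra.commutator_eq_zero
    by (metis eq_iff_diff_eq_0)
  have character: "\<exists>f\<in>characters smul. cmod (f x) = 1" if p: "uniform_seminorm smul p" "p x = 1" for p x
  proof -
    obtain q where q: "uniform_seminorm smul q" "q x = 1"
      and minimal: "\<And>r. uniform_seminorm smul r \<Longrightarrow> r x = 1 \<Longrightarrow> r \<le> q \<Longrightarrow> r = q"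
      using exists_minimal_uniform_seminorm[OF p] by blast
    interpret uniform_seminormed_algebra smul q
      using q(1) by (rule uniform_algebra)
    interpret commutative_uniform_seminormed_algebra smul q
      by unfold_locales (rule commute)
    interpret multiplicative_seminormed_algebra smul q
      using mult_eq_if_minimal[OF q(2) minimal] commute by unfold_locales
    show ?thesis
      using q(2) by (rule exists_character)
  qed
  \<comment> \<open>A nonzero element has nonzero value under some \<open>p\<close> in
    \<open>P\<close>; rescaled to value \<open>1\<close>, it provides a character.\<close>
  obtain z :: 'a where "z \<noteq> 0"
    using assms(1) by blast
  then obtain p where p: "p \<in> P" "p z \<noteq> 0"
    using eq_zero by blast
  interpret uniform_seminormed_algebra smul p
    using p(1) uniform uniform_algebra by blast
  have "p (smul (of_real (1 / p z)) z) = 1"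
    using p(2) by (simp add: homogeneous norm_divide)
  then have "characters smul \<noteq> {}"
    using character[OF uniform[OF p(1)]] by blast
  moreover have "\<exists>f\<in>characters smul. 1 \<le> cmod (f x)" if "p \<in> P" "p x = 1" for p x
    using character[OF uniform[OF that(1)] that(2)] by force
  ultimately show ?thesis
    unfolding property_P_def using P uniform by (intro conjI exI[of _ P]) (auto simp: uniform_seminorm_def)
qed

lemma property_P_if_saturated:
  assumes "saturated_algebra smul"
  shows "property_P smul"
proof -
  from assms obtain e P where "characters smul \<noteq> {}" and e: "\<forall>x. e * x = x \<and> x * e = x"
    and P: "\<forall>p\<in>P. seminorm smul p" "determines_topology P" and unit: "\<forall>p\<in>P. p e = 1"
    and sup: "\<forall>x. \<forall>p\<in>P. p x = 1 \<longrightarrow> (\<exists>f\<^sub>0\<in>characters smul. \<exists>f\<in>characters smul.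
      ereal (cmod (f\<^sub>0 x)) = (SUP y\<in>{y. p y \<le> 1}. ereal (cmod (f y))))"
    unfolding saturated_algebra_def by (elim conjE exE) (rule that)
  have "\<exists>f\<in>characters smul. 1 \<le> cmod (f x)" if "p \<in> P" "p x = 1" for p x
  proof -
    obtain f\<^sub>0 f where f: "f\<^sub>0 \<in> characters smul" "f \<in> characters smul"
      "ereal (cmod (f\<^sub>0 x)) = (SUP y\<in>{y. p y \<le> 1}. ereal (cmod (f y)))"
      using sup[rule_format, OF \<open>p \<in> P\<close> \<open>p x = 1\<close>] by (elim bexE) (rule that)
    obtain y where "f y \<noteq> 0" "f (e * y) = f e * f y"
      using f(2) by (auto simp: characters_def fun_eq_iff)
    then have "f e = 1"
      using e by simp
    \<comment> \<open>Since \<open>p e = 1\<close>, the unit is among the \<open>y\<close> of the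
      supremum and contributes \<open>cmod (f e) = 1\<close>.\<close>
    then have "ereal 1 \<le> ereal (cmod (f\<^sub>0 x))"
      unfolding f(3) using unit[rule_format, OF \<open>p \<in> P\<close>] by (intro SUP_upper2[of e]) simp_all
    then show ?thesis
      using f(1) by auto
  qed
  then show ?thesis
    unfolding property_P_def using \<open>characters smul \<noteq> {}\<close> P by blast
qed

theorem mainTheorem6:
  fixes smul :: "complex \<Rightarrow> 'a::{ring, t2_space, topological_ab_group_add} \<Rightarrow> 'a"
  assumes "topological_algebra smul"
    and "(UNIV :: 'a set) \<noteq> {0}"
    and "uniform_topological_algebra smul \<or> saturated_algebra smul"
  shows "property_P smul"
  using assms(2,3) property_P_if_uniform property_P_if_saturated by blast

end
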